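(* Let $w\in\mathcal A$ and $N\in[1,\infty)$, and let $\tilde R_N$ denote the $N$-Ricci tensor associated to the operator $\tilde L=e^{-2w}\big(L+(N-2)\Gamma(w,\cdot)\big)$. Then for all $u\in\mathcal A$, pointwise on $X$, $$\tilde R_N(u)=e^{-4w}\Big(R_N(u)+\big[-Lw-(N-2)\Gamma(w)\big]\,\Gamma(u)-(N-2)H_w(u,u)+(N-2)\Gamma(w,u)^2\Big).$$
   Context: Let $X$ be a set, $\mathcal A$ an algebra of real-valued functions on $X$ and $L:\mathcal A\to\mathcal A$ a linear operator. Put $\Gamma(f,g)=\frac12[L(fg)-fLg-gLf]$ and $\Gamma(f)=\Gamma(f,f)$. $L$ is assumed to be a diffusion operator: $\Gamma(f)\ge0$ for all $f\in\mathcal A$, and for all $r$, all $f_1,\dots,f_r\in\mathcal A$ and every $C^\infty$ function $\psi:\mathbb R^r\to\mathbb R$ with $\psi(0)=0$ one has $\psi(f_1,\dots,f_r)\in\mathcal A$ and $L\psi(f_1,\dots,f_r)=\sum_i\psi_i(f_1,\dots,f_r)\,Lf_i+\sum_{i,j}\psi_{ij}(f_1,\dots,f_r)\,\Gamma(f_i,f_j)$, where $\psi_i,\psi_{ij}$ are partial derivatives. $L,\Gamma$ are extended to the algebra generated by $\mathcal A$ and the constants by $L1=0$, $\Gamma(1,f)=0$. Define $\Gamma_2(f,g)=\frac12[L\Gamma(f,g)-\Gamma(f,Lg)-\Gamma(g,Lf)]$, $\Gamma_2(f)=\Gamma_2(f,f)$, the Hessian $H_f(g,h)=\frac12[\Gamma(g,\Gamma(f,h))+\Gamma(h,\Gamma(f,g))-\Gamma(f,\Gamma(g,h))]$,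 and for $N\in[1,\infty]$ the $N$-Ricci tensor $R_N(f)(x)=\inf\{\Gamma_2(\tilde f)(x)-\frac1N(L\tilde f)^2(x):\tilde f\in\mathcal A,\ \Gamma(\tilde f-f)(x)=0\}\in[-\infty,\infty)$. $\tilde R_N$ is defined by the same formulas with $\tilde L$ (and its square field operators $\tilde\Gamma,\tilde\Gamma_2$) in place of $L$. *)

theory Defs
  imports "HOL-Analysis.Analysis"
begin

(* Since the diffusion property quantifies over the number r of functions, R^r is the library's
   Euclidean_space r: sequences nat => real that vanish from index r on. Coordinates are
   numbered 0, ..., r - 1, and functions on R^r matter only on topspace (Euclidean_space r). *)

definition partial_deriv :: "nat \<Rightarrow> ((nat \<Rightarrow> real) \<Rightarrow> real) \<Rightarrow> (nat \<Rightarrow> real) \<Rightarrow> real" where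
  "partial_deriv i \<psi> x = deriv (\<lambda>t. \<psi> (x(i := t))) (x i)"

primrec C_k :: "nat \<Rightarrow> nat \<Rightarrow> ((nat \<Rightarrow> real) \<Rightarrow> real) \<Rightarrow> bool" where
  "C_k r 0 \<psi> \<longleftrightarrow> continuous_map (Euclidean_space r) euclideanreal \<psi>"
| "C_k r (Suc k) \<psi> \<longleftrightarrow> continuous_map (Euclidean_space r) euclideanreal \<psi> \<and>
     (\<forall>i<r. (\<forall>x\<in>topspace (Euclidean_space r).
               (\<lambda>t. \<psi> (x(i := t))) field_differentiable (at (x i))) \<and>
            C_k r k (partial_deriv i \<psi>))"

definition C_infinity :: "nat \<Rightarrow> ((nat \<Rightarrow> real) \<Rightarrow> real) \<Rightarrow> bool" where
  "C_infinity r \<psi> \<longleftrightarrow> (\<forall>k. C_k r k \<psi>)"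

(* The point (f_1(x), ..., f_r(x)) of R^r. *)
definition tuple_at :: "nat \<Rightarrow> (nat \<Rightarrow> 'a \<Rightarrow> real) \<Rightarrow> 'a \<Rightarrow> nat \<Rightarrow> real" where
  "tuple_at r f x = (\<lambda>i. if i < r then f i x else 0)"

type_synonym 'a operator = "('a \<Rightarrow> real) \<Rightarrow> ('a \<Rightarrow> real)"

definition sq_field :: "'a operator \<Rightarrow> ('a \<Rightarrow> real) \<Rightarrow> ('a \<Rightarrow> real) \<Rightarrow> 'a \<Rightarrow> real" where
  "sq_field L f g = (\<lambda>x. (L (\<lambda>y. f y * g y) x - f x * L g x - g x * L f x) / 2)"

definition sq_field2 :: "'a operator \<Rightarrow> ('a \<Rightarrow> real) \<Rightarrow> ('a \<Rightarrow> real) \<Rightarrow> 'a \<Rightarrow> real" where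
  "sq_field2 L f g =
     (\<lambda>x. (L (sq_field L f g) x - sq_field L f (L g) x - sq_field L g (L f) x) / 2)"

definition Hessian ::
    "'a operator \<Rightarrow> ('a \<Rightarrow> real) \<Rightarrow> ('a \<Rightarrow> real) \<Rightarrow> ('a \<Rightarrow> real) \<Rightarrow> 'a \<Rightarrow> real" where
  "Hessian L f g h =
     (\<lambda>x. (sq_field L g (sq_field L f h) x + sq_field L h (sq_field L f g) x
           - sq_field L f (sq_field L g h) x) / 2)"

(* The dimension N lies in [1, \<infinity>]; for N = \<infinity> the coefficient 1 / N is 0. *)
definition N_Ricci ::
    "('a \<Rightarrow> real) set \<Rightarrow> 'a operator \<Rightarrow> ereal \<Rightarrow> ('a \<Rightarrow> real) \<Rightarrow> 'a \<Rightarrow> ereal" where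
  "N_Ricci A L N f x =
     (INF g \<in> {g \<in> A. sq_field L (\<lambda>y. g y - f y) (\<lambda>y. g y - f y) x = 0}.
        ereal (sq_field2 L g g x - real_of_ereal (1 / N) * (L g x)\<^sup>2))"

locale function_algebra =
  fixes A :: "('a \<Rightarrow> real) set"
  assumes zero_mem: "(\<lambda>x. 0) \<in> A"
    and add_mem: "\<lbrakk>f \<in> A; g \<in> A\<rbrakk> \<Longrightarrow> (\<lambda>x. f x + g x) \<in> A"
    and scale_mem: "f \<in> A \<Longrightarrow> (\<lambda>x. c * f x) \<in> A"
    and mult_mem: "\<lbrakk>f \<in> A; g \<in> A\<rbrakk> \<Longrightarrow> (\<lambda>x. f x * g x) \<in> A"

(* L is only constrained on A. The extension of L to constants by L 1 = 0 is not needed to state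
   anything below: all operators are applied to members of A only. *)
locale diffusion_operator = function_algebra A
  for A :: "('a \<Rightarrow> real) set" +
  fixes L :: "'a operator"
  assumes L_mem: "f \<in> A \<Longrightarrow> L f \<in> A"
    and L_add: "\<lbrakk>f \<in> A; g \<in> A\<rbrakk> \<Longrightarrow> L (\<lambda>x. f x + g x) = (\<lambda>x. L f x + L g x)"
    and L_scale: "f \<in> A \<Longrightarrow> L (\<lambda>x. c * f x) = (\<lambda>x. c * L f x)"
    and sq_field_nonneg: "f \<in> A \<Longrightarrow> sq_field L f f x \<ge> 0"
    and compose_mem: "\<lbrakk>C_infinity r \<psi>; \<psi> (\<lambda>_. 0) = 0; \<And>i. i < r \<Longrightarrow> F i \<in> A\<rbrakk> \<Longrightarrow>
      (\<lambda>x. \<psi> (tuple_at r F x)) \<in> A"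
    and L_compose: "\<lbrakk>C_infinity r \<psi>; \<psi> (\<lambda>_. 0) = 0; \<And>i. i < r \<Longrightarrow> F i \<in> A\<rbrakk> \<Longrightarrow>
      L (\<lambda>x. \<psi> (tuple_at r F x)) =
      (\<lambda>x. (\<Sum>i<r. partial_deriv i \<psi> (tuple_at r F x) * L (F i) x) +
           (\<Sum>i<r. \<Sum>j<r. partial_deriv j (partial_deriv i \<psi>) (tuple_at r F x) *
                           sq_field L (F i) (F j) x))"

end

theory Submission
  imports Defs
begin

text \<open>
  Write \<open>\<Gamma>\<close> for the square field and \<open>D f = \<Gamma>\<^sub>2(f) - (L f)\<^sup>2 / N\<close>, and let \<open>D' f\<close> be formed in the same way
  from the conformally changed operator. The \<open>N\<close>-Ricci tensor at \<open>x\<close> is the infimum of \<open>D f (x)\<close> over the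
  competitors, the \<open>f\<close> with the same differential at \<open>x\<close> as \<open>u\<close> in the sense that \<open>\<Gamma>(f - u)(x) = 0\<close>. Both
  operators have the same competitors. Adding a multiple of the quadratic function
  \<open>q = (g - g(x)) (w - w(x))\<close> to a competitor gives another one, and at \<open>x\<close>
  \<open>L(f + c q) = L f + 2 c \<Gamma>(g, w)\<close> and
  \<open>\<Gamma>\<^sub>2(f + c q) = \<Gamma>\<^sub>2(f) + 4 c H\<^sub>f(g, w) + 2 c\<^sup>2 (\<Gamma>(g) \<Gamma>(w) + \<Gamma>(g, w)\<^sup>2)\<close>
  (lemma \<open>perturb\<close>).

  With \<open>g = f\<close>, subtracting \<open>q\<close> imitates the change of the Hessian of \<open>f\<close> under the conformal change. On a
  manifold that change consists of \<open>- df \<otimes> dw - dw \<otimes> df\<close>, which is the Hessian of \<open>- q\<close>, and a multiple of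
  the metric; the latter is accounted for by the square \<open>(L f)\<^sup>2 / N\<close>, because the same \<open>N\<close> occurs in the
  drift. The result is two exact identities at \<open>x\<close>,
  \<open>D' f = exp (- 4 w) (D (f - q) + C f)\<close> and \<open>D' (f + q) = exp (- 4 w) (D f + C f)\<close>
  (lemmas \<open>conf_defect\<close> and \<open>conf_defect_perturb\<close>), where \<open>C u\<close> is the term added to the Ricci tensor in the
  theorem. They compare the two infima in both directions, provided that \<open>C f = C u\<close> at \<open>x\<close> for all
  competitors.

  The correction \<open>C f\<close> contains \<open>H\<^sub>w(f, f)\<close>, and at this level of generality the Hessian need not be determined
  by the differential of \<open>f\<close> at \<open>x\<close>. It is not for \<open>L = X\<^sup>2 + Y\<^sup>2\<close> on the Heisenberg group, where the
  commutator of \<open>X\<close> and \<open>Y\<close> leaves the horizontal directions. But if \<open>H\<^sub>w(f, f) \<noteq> H\<^sub>w(u, u)\<close> at \<open>x\<close> for a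
  competitor, then \<open>H\<^sub>f(g, w) \<noteq> 0\<close> at \<open>x\<close> for some competitor \<open>f\<close> and some \<open>g\<close> with \<open>\<Gamma>(g)(x) = 0\<close>. In
  the perturbation formula only the term \<open>4 c H\<^sub>f(g, w)\<close> then survives, so both Ricci tensors are \<open>- \<infinity>\<close>, and
  the theorem holds again (lemma \<open>N_Ricci_degenerate\<close>).

  All computations rest on \<open>\<Gamma>\<close> being a nonnegative form with the Leibniz rule. Since the changed operator
  inherits this, the perturbation lemmas apply to it as well.
\<close>

section \<open>Smooth functions built from sums, products and exponentials\<close>

text \<open>
  Smoothness is an infinite tower of conditions on partial derivatives. A class of differentiable functions
  closed under partial differentiation satisfies all of them at once; this class contains the functions that
  express the product rules and the weight \<open>exp (b w)\<close>.
\<close>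

inductive exp_polynomial :: "((nat \<Rightarrow> real) \<Rightarrow> real) \<Rightarrow> bool" where
  const: "exp_polynomial (\<lambda>x. c)"
| coord: "exp_polynomial (\<lambda>x. x i)"
| add: "exp_polynomial \<phi> \<Longrightarrow> exp_polynomial \<psi> \<Longrightarrow> exp_polynomial (\<lambda>x. \<phi> x + \<psi> x)"
| mult: "exp_polynomial \<phi> \<Longrightarrow> exp_polynomial \<psi> \<Longrightarrow> exp_polynomial (\<lambda>x. \<phi> x * \<psi> x)"
| exp: "exp_polynomial \<phi> \<Longrightarrow> exp_polynomial (\<lambda>x. exp (\<phi> x))"

lemma exp_polynomial_continuous:
  assumes "exp_polynomial \<psi>"
  shows "continuous_map (Euclidean_space r) euclideanreal \<psi>"
  using assms
proof induction
  case (coord i)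
  show ?case
    unfolding Euclidean_space_def
    by (rule continuous_map_from_subtopology) (rule continuous_map_product_projection, simp)
next
  case (exp \<phi>)
  have "continuous_map euclideanreal euclideanreal (exp :: real \<Rightarrow> real)"
    by (simp add: continuous_on_exp continuous_on_id)
  from continuous_map_compose[OF exp.IH this] show ?case
    by (simp add: o_def)
qed (simp_all add: continuous_map_real_mult continuous_map_add)

text \<open>
  One function has to serve as the partial derivative at all points, as it is to be differentiated again.
\<close>
lemma exp_polynomial_deriv:
  assumes "exp_polynomial \<psi>"
  obtains \<psi>' where "exp_polynomial \<psi>'"
    "\<And>x. ((\<lambda>t. \<psi> (x(i := t))) has_field_derivative \<psi>' x) (at (x i))"
proof -
  have "\<exists>\<psi>'. exp_polynomial \<psi>' \<and>
      (\<forall>x. ((\<lambda>t. \<psi> (x(i := t))) has_field_derivative \<psi>' x) (at (x i)))"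
    using assms
  proof induction
    case (const c)
    show ?case
      by (intro exI[of _ "\<lambda>x. 0"]) (simp add: exp_polynomial.const)
  next
    case (coord j)
    show ?case
      by (intro exI[of _ "\<lambda>x. if j = i then 1 else 0"]) (auto simp: exp_polynomial.const)
  next
    case (add \<phi> \<psi>)
    then obtain \<phi>' \<psi>' where d: "exp_polynomial \<phi>'" "exp_polynomial \<psi>'"
      "\<And>x. ((\<lambda>t. \<phi> (x(i := t))) has_field_derivative \<phi>' x) (at (x i))"
      "\<And>x. ((\<lambda>t. \<psi> (x(i := t))) has_field_derivative \<psi>' x) (at (x i))"
      by blast
    show ?case
      by (intro exI[of _ "\<lambda>x. \<phi>' x + \<psi>' x"] conjI allI exp_polynomial.add DERIV_add d)
  next
    case (mult \<phi> \<psi>)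
    then obtain \<phi>' \<psi>' where d: "exp_polynomial \<phi>'" "exp_polynomial \<psi>'"
      "\<And>x. ((\<lambda>t. \<phi> (x(i := t))) has_field_derivative \<phi>' x) (at (x i))"
      "\<And>x. ((\<lambda>t. \<psi> (x(i := t))) has_field_derivative \<psi>' x) (at (x i))"
      by blast
    have "((\<lambda>t. \<phi> (x(i := t)) * \<psi> (x(i := t))) has_field_derivative \<phi>' x * \<psi> x + \<psi>' x * \<phi> x)
        (at (x i))" for x
      using DERIV_mult[OF d(3)[of x] d(4)[of x]] by simp
    then show ?case
      by (intro exI[of _ "\<lambda>x. \<phi>' x * \<psi> x + \<psi>' x * \<phi> x"] conjI allI
          exp_polynomial.add exp_polynomial.mult d mult.hyps)
  next
    case (exp \<phi>)
    then obtain \<phi>' where d: "exp_polynomial \<phi>'"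
      "\<And>x. ((\<lambda>t. \<phi> (x(i := t))) has_field_derivative \<phi>' x) (at (x i))"
      by blast
    have "((\<lambda>t. exp (\<phi> (x(i := t)))) has_field_derivative exp (\<phi> x) * \<phi>' x) (at (x i))" for x
      using DERIV_fun_exp[OF d(2)[of x]] by simp
    then show ?case
      by (intro exI[of _ "\<lambda>x. exp (\<phi> x) * \<phi>' x"] conjI allI
          exp_polynomial.mult exp_polynomial.exp d exp.hyps)
  qed
  then show thesis using that by blast
qed

lemma partial_deriv_eqI:
  assumes "\<And>x. ((\<lambda>t. \<psi> (x(i := t))) has_field_derivative \<psi>' x) (at (x i))"
  shows "partial_deriv i \<psi> = \<psi>'"
  unfolding partial_deriv_def using DERIV_imp_deriv[OF assms] by auto

lemma exp_polynomial_C_infinity: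
  assumes "exp_polynomial \<psi>"
  shows "C_infinity r \<psi>"
proof -
  have "C_k r k \<psi>" for k
    using assms
  proof (induction k arbitrary: \<psi>)
    case 0
    then show ?case by (simp add: exp_polynomial_continuous)
  next
    case (Suc k)
    show ?case
    proof (simp add: exp_polynomial_continuous[OF Suc.prems], intro allI impI conjI ballI)
      fix i
      obtain \<psi>' where \<psi>': "exp_polynomial \<psi>'"
        "\<And>x. ((\<lambda>t. \<psi> (x(i := t))) has_field_derivative \<psi>' x) (at (x i))"
        using exp_polynomial_deriv[OF Suc.prems] by blast
      show "(\<lambda>t. \<psi> (x(i := t))) field_differentiable at (x i)" for x
        using \<psi>'(2) by (auto simp: field_differentiable_def)
      show "C_k r k (partial_deriv i \<psi>)"
        using Suc.IH[OF \<psi>'(1)] by (simp add: partial_deriv_eqI[OF \<psi>'(2)])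
    qed
  qed
  then show ?thesis by (simp add: C_infinity_def)
qed

section \<open>Operators whose square field is a derivation\<close>

text \<open>
  A diffusion operator enters the computation only through these properties. They are inherited
  by the conformally changed operator by a short calculation, so every result of the
  locale is available for both operators.
\<close>
locale leibniz_operator = function_algebra A
  for A :: "('a \<Rightarrow> real) set" +
  fixes L :: "'a operator"
  assumes L_mem: "f \<in> A \<Longrightarrow> L f \<in> A"
    and L_add: "\<lbrakk>f \<in> A; g \<in> A\<rbrakk> \<Longrightarrow> L (\<lambda>x. f x + g x) = (\<lambda>x. L f x + L g x)"
    and L_scale: "f \<in> A \<Longrightarrow> L (\<lambda>x. c * f x) = (\<lambda>x. c * L f x)"
    and sq_field_nonneg: "f \<in> A \<Longrightarrow> sq_field L f f x \<ge> 0"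
    and sq_field_mult: "\<lbrakk>f \<in> A; g \<in> A; h \<in> A\<rbrakk> \<Longrightarrow>
      sq_field L (\<lambda>y. f y * g y) h = (\<lambda>y. f y * sq_field L g h y + g y * sq_field L f h y)"
begin

abbreviation "\<Gamma> \<equiv> sq_field L"
abbreviation "\<Gamma>\<^sub>2 \<equiv> sq_field2 L"

lemma diff_mem: "\<lbrakk>f \<in> A; g \<in> A\<rbrakk> \<Longrightarrow> (\<lambda>x. f x - g x) \<in> A"
  using add_mem[OF _ scale_mem[of g "-1"], of f] by simp

lemma sq_field_mem: "\<lbrakk>f \<in> A; g \<in> A\<rbrakk> \<Longrightarrow> \<Gamma> f g \<in> A"
proof -
  assume "f \<in> A" "g \<in> A"
  then have "(\<lambda>x. (1/2) * (L (\<lambda>y. f y * g y) x - f x * L g x - g x * L f x)) \<in> A"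
    by (intro scale_mem diff_mem mult_mem L_mem)
  then show ?thesis by (simp add: sq_field_def)
qed

lemmas mem = add_mem scale_mem mult_mem L_mem diff_mem sq_field_mem

lemma L_diff: "\<lbrakk>f \<in> A; g \<in> A\<rbrakk> \<Longrightarrow> L (\<lambda>x. f x - g x) = (\<lambda>x. L f x - L g x)"
  using L_add[OF _ scale_mem[of g "-1"], of f] L_scale[of g "-1"] by simp

lemma L_mult: "\<lbrakk>f \<in> A; g \<in> A\<rbrakk> \<Longrightarrow> L (\<lambda>y. f y * g y) = (\<lambda>y. f y * L g y + g y * L f y + 2 * \<Gamma> f g y)"
  by (simp add: sq_field_def field_simps)

lemma sq_field_sym: "\<Gamma> f g = \<Gamma> g f"
  by (simp add: sq_field_def mult.commute algebra_simps)

lemma sq_field_add: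
  "\<lbrakk>f \<in> A; g \<in> A; h \<in> A\<rbrakk> \<Longrightarrow> \<Gamma> (\<lambda>y. f y + g y) h = (\<lambda>y. \<Gamma> f h y + \<Gamma> g h y)"
  by (simp add: fun_eq_iff sq_field_def distrib_right L_add mult_mem) (simp add: field_simps)

lemma sq_field_scale: "\<lbrakk>f \<in> A; h \<in> A\<rbrakk> \<Longrightarrow> \<Gamma> (\<lambda>y. c * f y) h = (\<lambda>y. c * \<Gamma> f h y)"
  by (simp add: fun_eq_iff sq_field_def mult.assoc L_scale mult_mem) (simp add: field_simps)

lemma sq_field_diff:
  "\<lbrakk>f \<in> A; g \<in> A; h \<in> A\<rbrakk> \<Longrightarrow> \<Gamma> (\<lambda>y. f y - g y) h = (\<lambda>y. \<Gamma> f h y - \<Gamma> g h y)"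
  using sq_field_add[OF _ scale_mem[of g "-1"], of f] sq_field_scale[of g h "-1"] by simp

lemma sq_field_right:
  "\<lbrakk>f \<in> A; g \<in> A; h \<in> A\<rbrakk> \<Longrightarrow> \<Gamma> h (\<lambda>y. f y + g y) = (\<lambda>y. \<Gamma> h f y + \<Gamma> h g y)"
  "\<lbrakk>f \<in> A; g \<in> A; h \<in> A\<rbrakk> \<Longrightarrow> \<Gamma> h (\<lambda>y. f y - g y) = (\<lambda>y. \<Gamma> h f y - \<Gamma> h g y)"
  "\<lbrakk>f \<in> A; h \<in> A\<rbrakk> \<Longrightarrow> \<Gamma> h (\<lambda>y. c * f y) = (\<lambda>y. c * \<Gamma> h f y)"
  "\<lbrakk>f \<in> A; g \<in> A; h \<in> A\<rbrakk> \<Longrightarrow> \<Gamma> h (\<lambda>y. f y * g y) = (\<lambda>y. f y * \<Gamma> h g y + g y * \<Gamma> h f y)"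
  by (simp_all add: sq_field_sym[of h] sq_field_add sq_field_diff sq_field_scale sq_field_mult)

lemmas calculus =
  L_add L_diff L_scale L_mult sq_field_add sq_field_diff sq_field_scale sq_field_mult sq_field_right

text \<open>
  The Cauchy--Schwarz inequality in the degenerate case: the quadratic polynomial \<open>\<Gamma>(k + t g)(x)\<close> of \<open>t\<close>
  has no quadratic term and is nonnegative, so its linear term vanishes.
\<close>
lemma sq_field_null:
  assumes "g \<in> A" "k \<in> A" "\<Gamma> g g x = 0"
  shows "\<Gamma> g k x = 0" "\<Gamma> k g x = 0"
proof -
  have ineq: "\<Gamma> k k x + 2 * t * \<Gamma> g k x \<ge> 0" for t
  proof -
    have "0 \<le> \<Gamma> (\<lambda>y. k y + t * g y) (\<lambda>y. k y + t * g y) x"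
      using assms by (intro sq_field_nonneg mem)
    also have "\<dots> = \<Gamma> k k x + 2 * t * \<Gamma> g k x"
      using assms by (simp add: calculus mem sq_field_sym[of k g])
    finally show ?thesis .
  qed
  show "\<Gamma> g k x = 0"
  proof (rule ccontr)
    assume "\<Gamma> g k x \<noteq> 0"
    then show False
      \<comment> \<open>At this \<open>t\<close> the polynomial takes the value \<open>- 1\<close>.\<close>
      using ineq[of "- (\<Gamma> k k x + 1) / (2 * \<Gamma> g k x)"] by (simp add: field_simps)
  qed
  then show "\<Gamma> k g x = 0" by (simp add: sq_field_sym)
qed

lemma sq_field_cong:
  assumes "f \<in> A" "u \<in> A" "k \<in> A" "\<Gamma> (\<lambda>y. f y - u y) (\<lambda>y. f y - u y) x = 0"
  shows "\<Gamma> k f x = \<Gamma> k u x"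
  using sq_field_null(2)[of "\<lambda>y. f y - u y" k x] assms by (simp add: calculus mem)

text \<open>
  This is \<open>(g - g(x)) (w - w(x))\<close>, which vanishes to second order at \<open>x\<close>, minus its constant term
  \<open>g(x) w(x)\<close>: the algebra need not contain the constants.
\<close>
definition bump :: "'a \<Rightarrow> ('a \<Rightarrow> real) \<Rightarrow> ('a \<Rightarrow> real) \<Rightarrow> 'a \<Rightarrow> real" where
  "bump x g w = (\<lambda>y. g y * w y - g x * w y - w x * g y)"

lemma bump_mem: "\<lbrakk>g \<in> A; w \<in> A\<rbrakk> \<Longrightarrow> bump x g w \<in> A"
  unfolding bump_def by (intro mem)

lemma L_bump:
  assumes "g \<in> A" "w \<in> A"
  shows "L (bump x g w) =
    (\<lambda>y. (g y * L w y - g x * L w y) + (w y * L g y - w x * L g y) + 2 * \<Gamma> g w y)"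
  unfolding bump_def using assms by (simp add: calculus mem) (simp add: algebra_simps)

lemma sq_field_bump:
  assumes "g \<in> A" "w \<in> A" "k \<in> A"
  shows "\<Gamma> k (bump x g w) =
    (\<lambda>y. (g y * \<Gamma> k w y - g x * \<Gamma> k w y) + (w y * \<Gamma> k g y - w x * \<Gamma> k g y))"
  unfolding bump_def using assms by (simp add: calculus mem) (simp add: algebra_simps)

lemma sq_field_bump_at:
  assumes "g \<in> A" "w \<in> A" "k \<in> A"
  shows "\<Gamma> k (bump x g w) x = 0" "\<Gamma> (bump x g w) k x = 0"
  using assms by (simp_all add: sq_field_sym[of "bump x g w"] sq_field_bump)

lemma sq_field2_add_scale:
  assumes "f \<in> A" "q \<in> A"
  shows "\<Gamma>\<^sub>2 (\<lambda>y. f y + c * q y) (\<lambda>y. f y + c * q y) x =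
    \<Gamma>\<^sub>2 f f x + 2 * c * \<Gamma>\<^sub>2 f q x + c\<^sup>2 * \<Gamma>\<^sub>2 q q x"
  using assms
  by (simp add: sq_field2_def calculus mem sq_field_sym[of q f])
     (simp add: field_simps power2_eq_square)

text \<open>
  In \<open>L \<Gamma>(f, q) - \<Gamma>(f, L q)\<close>, for the bump \<open>q\<close>, the terms with \<open>L g\<close> and \<open>L w\<close> cancel. The iterated
  square fields that remain are exactly those of the Hessian.
\<close>
lemma sq_field2_bump_mixed:
  assumes "f \<in> A" "g \<in> A" "w \<in> A"
  shows "\<Gamma>\<^sub>2 f (bump x g w) x = 2 * Hessian L f g w x"
  using assms
  by (simp add: sq_field2_def Hessian_def sq_field_bump sq_field_bump_at L_bump calculus mem
      sq_field_sym field_simps)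

lemma sq_field2_bump:
  assumes "g \<in> A" "w \<in> A"
  shows "\<Gamma>\<^sub>2 (bump x g w) (bump x g w) x = 2 * (\<Gamma> g g x * \<Gamma> w w x + (\<Gamma> g w x)\<^sup>2)"
  using assms
  by (simp add: sq_field2_def sq_field_bump sq_field_bump_at L_bump calculus mem bump_mem)
     (simp add: sq_field_sym[of "bump x g w"] sq_field_sym[of w g] sq_field_bump calculus mem
       power2_eq_square field_simps)

lemma perturb:
  fixes c :: real and x :: 'a
  assumes "f \<in> A" "g \<in> A" "w \<in> A"
  defines "p \<equiv> \<lambda>y. f y + c * bump x g w y"
  shows perturb_mem: "p \<in> A"
    and perturb_L: "L p x = L f x + 2 * c * \<Gamma> g w x"
    and perturb_sq_field: "k \<in> A \<Longrightarrow> \<Gamma> k p x = \<Gamma> k f x"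
    and perturb_sq_field2: "\<Gamma>\<^sub>2 p p x = \<Gamma>\<^sub>2 f f x + 4 * c * Hessian L f g w x +
      2 * c\<^sup>2 * (\<Gamma> g g x * \<Gamma> w w x + (\<Gamma> g w x)\<^sup>2)"
  using assms
  by (simp_all add: mem bump_mem calculus L_bump sq_field_bump_at sq_field2_add_scale sq_field2_bump)
     (simp add: sq_field2_bump_mixed)

text \<open>The bump has zero differential at \<open>x\<close>, so adding it keeps a function a competitor.\<close>
lemma perturb_admissible:
  assumes "f \<in> A" "g \<in> A" "w \<in> A" "u \<in> A" "\<Gamma> (\<lambda>y. f y - u y) (\<lambda>y. f y - u y) x = 0"
  shows "\<Gamma> (\<lambda>y. (f y + c * bump x g w y) - u y) (\<lambda>y. (f y + c * bump x g w y) - u y) x = 0"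
  using assms
  by (simp add: mem bump_mem calculus sq_field_bump_at)

lemma Hessian_self: "\<lbrakk>f \<in> A; w \<in> A\<rbrakk> \<Longrightarrow> Hessian L f f w x = \<Gamma> w (\<Gamma> f f) x / 2"
  by (simp add: Hessian_def)

text \<open>
  The first of the three terms defining the Hessian vanishes for \<open>g\<close> with zero differential at \<open>x\<close>, and the
  other two are antisymmetric in \<open>w\<close> and \<open>f\<close>. This relates the term \<open>H\<^sub>w(g, f)\<close>, which is the obstruction
  to tensoriality of \<open>H\<^sub>w\<close>, to the term \<open>H\<^sub>f(g, w)\<close>, which a bump adds to \<open>\<Gamma>\<^sub>2(f)\<close>.
\<close>
lemma Hessian_null:
  assumes "f \<in> A" "g \<in> A" "w \<in> A" "\<Gamma> g g x = 0"
  shows "Hessian L w g f x = - Hessian L f g w x"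
  using assms sq_field_null[of g "\<Gamma> f w" x]
  by (simp add: Hessian_def mem sq_field_sym[of w f] sq_field_sym[of w g] sq_field_sym[of f g]
      field_simps)

lemma Hessian_cong:
  assumes "f \<in> A" "u \<in> A" "w \<in> A"
    and "Hessian L w (\<lambda>y. f y - u y) f x = 0" "Hessian L w (\<lambda>y. f y - u y) u x = 0"
  shows "Hessian L w f f x = Hessian L w u u x"
  using assms
  by (simp add: Hessian_def calculus mem sq_field_sym[of u f])

text \<open>
  If \<open>\<Gamma>(g)(x) = 0\<close>, adding \<open>c\<close> times the bump of \<open>g\<close> and \<open>w\<close> leaves \<open>L f (x)\<close> unchanged and changes
  \<open>\<Gamma>\<^sub>2(f)(x)\<close> linearly in \<open>c\<close>. With a nonzero slope every real value is attained.
\<close>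
lemma N_Ricci_degenerate:
  assumes "u \<in> A" "f \<in> A" "g \<in> A" "w \<in> A"
    and "\<Gamma> (\<lambda>y. f y - u y) (\<lambda>y. f y - u y) x = 0" "\<Gamma> g g x = 0" "Hessian L f g w x \<noteq> 0"
  shows "N_Ricci A L N u x = -\<infinity>"
proof (rule ereal_bot)
  fix B :: real
  define E where "E = \<Gamma>\<^sub>2 f f x - real_of_ereal (1 / N) * (L f x)\<^sup>2"
  \<comment> \<open>The coefficient for which the competitor attains the value \<open>B\<close>.\<close>
  define c where "c = (B - E) / (4 * Hessian L f g w x)"
  define p where "p = (\<lambda>y. f y + c * bump x g w y)"
  have "\<Gamma> g w x = 0"
    by (rule sq_field_null(1)) (use assms in auto)
  then have "\<Gamma>\<^sub>2 p p x - real_of_ereal (1 / N) * (L p x)\<^sup>2 = E + 4 * c * Hessian L f g w x"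
    unfolding p_def E_def using assms by (simp add: perturb_L perturb_sq_field2)
  also have "\<dots> = B"
    using assms by (simp add: c_def field_simps)
  finally have "ereal (\<Gamma>\<^sub>2 p p x - real_of_ereal (1 / N) * (L p x)\<^sup>2) = ereal B"
    by simp
  moreover have "p \<in> {g \<in> A. \<Gamma> (\<lambda>y. g y - u y) (\<lambda>y. g y - u y) x = 0}"
    unfolding p_def using assms by (simp add: perturb_mem perturb_admissible)
  ultimately show "N_Ricci A L N u x \<le> ereal B"
    unfolding N_Ricci_def by (intro INF_lower2[of p]) auto
qed

end

section \<open>Diffusion operators have a Leibniz rule\<close>

lemma (in diffusion_operator) compose_exp_polynomial:
  assumes "exp_polynomial \<psi>" "\<psi> (\<lambda>_. 0) = 0" "\<And>i. i < r \<Longrightarrow> F i \<in> A"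
  assumes "\<And>i x. ((\<lambda>t. \<psi> (x(i := t))) has_field_derivative \<psi>' i x) (at (x i))"
  assumes "\<And>i j x. ((\<lambda>t. \<psi>' i (x(j := t))) has_field_derivative \<psi>'' i j x) (at (x j))"
  shows "(\<lambda>x. \<psi> (tuple_at r F x)) \<in> A"
   and "L (\<lambda>x. \<psi> (tuple_at r F x)) = (\<lambda>x. (\<Sum>i<r. \<psi>' i (tuple_at r F x) * L (F i) x) +
      (\<Sum>i<r. \<Sum>j<r. \<psi>'' i j (tuple_at r F x) * sq_field L (F i) (F j) x))"
proof -
  have "partial_deriv i \<psi> = \<psi>' i" "partial_deriv j (\<psi>' i) = \<psi>'' i j" for i j
    by (intro partial_deriv_eqI assms)+
  then show "(\<lambda>x. \<psi> (tuple_at r F x)) \<in> A"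
   and "L (\<lambda>x. \<psi> (tuple_at r F x)) = (\<lambda>x. (\<Sum>i<r. \<psi>' i (tuple_at r F x) * L (F i) x) +
      (\<Sum>i<r. \<Sum>j<r. \<psi>'' i j (tuple_at r F x) * sq_field L (F i) (F j) x))"
    using assms(1-3) compose_mem[of r \<psi> F] L_compose[of r \<psi> F]
    by (simp_all add: exp_polynomial_C_infinity)
qed


text \<open>
  Subtracting \<open>1\<close> makes the outer function vanish at \<open>0\<close>, as the diffusion property demands. The
  next two lemmas are the chain rules for \<open>L\<close> and for the square field.
\<close>
lemma (in diffusion_operator) exp_weight:
  fixes b :: real
  assumes "w \<in> A"
  defines "e \<equiv> \<lambda>y. exp (b * w y) + (-1)"
  shows exp_weight_mem: "e \<in> A"
    and exp_weight_L: "L e = (\<lambda>y. exp (b * w y) * (b * L w y + b\<^sup>2 * sq_field L w w y))"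
proof -
  let ?\<psi> = "\<lambda>x::nat \<Rightarrow> real. exp (b * x 0) + (-1)"
  let ?\<psi>' = "\<lambda>(i::nat) x::nat \<Rightarrow> real. if i = 0 then b * exp (b * x 0) else 0"
  let ?\<psi>'' = "\<lambda>(i::nat) (j::nat) x::nat \<Rightarrow> real. if i = 0 \<and> j = 0 then b\<^sup>2 * exp (b * x 0) else 0"
  have p: "exp_polynomial ?\<psi>"
    by (intro exp_polynomial.intros)
  have d1: "((\<lambda>t. ?\<psi> (x(i := t))) has_field_derivative ?\<psi>' i x) (at (x i))" for i x
    by (cases "i = 0") (auto intro!: derivative_eq_intros)
  have d2: "((\<lambda>t. ?\<psi>' i (x(j := t))) has_field_derivative ?\<psi>'' i j x) (at (x j))" for i j x
    by (cases "i = 0"; cases "j = 0") (auto intro!: derivative_eq_intros simp: power2_eq_square)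
  note compose = compose_exp_polynomial[OF p _ _ d1 d2, where r = 1 and F = "\<lambda>i. w"]
  show "e \<in> A"
    using compose(1) assms by (simp add: tuple_at_def)
  show "L e = (\<lambda>y. exp (b * w y) * (b * L w y + b\<^sup>2 * sq_field L w w y))"
    using compose(2) assms by (simp add: tuple_at_def algebra_simps)
qed

lemma (in diffusion_operator) exp_weight_sq_field:
  assumes "w \<in> A" "f \<in> A"
  shows "sq_field L (\<lambda>y. exp (b * w y) + (-1)) f = (\<lambda>y. b * exp (b * w y) * sq_field L w f y)"
proof -
  let ?\<psi> = "\<lambda>x::nat \<Rightarrow> real. (exp (b * x 0) + (-1)) * x 1"
  let ?\<psi>' = "\<lambda>(i::nat) x::nat \<Rightarrow> real. if i = 0 then b * exp (b * x 0) * x 1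
                else if i = 1 then exp (b * x 0) + (-1) else 0"
  let ?\<psi>'' = "\<lambda>(i::nat) (j::nat) x::nat \<Rightarrow> real. if i = 0 \<and> j = 0 then b\<^sup>2 * exp (b * x 0) * x 1
                else if i = 0 \<and> j = 1 \<or> i = 1 \<and> j = 0 then b * exp (b * x 0) else 0"
  have p: "exp_polynomial ?\<psi>"
    by (intro exp_polynomial.intros)
  have d1: "((\<lambda>t. ?\<psi> (x(i := t))) has_field_derivative ?\<psi>' i x) (at (x i))" for i x
    by (cases "i = 0"; cases "i = 1") (auto intro!: derivative_eq_intros)
  have d2: "((\<lambda>t. ?\<psi>' i (x(j := t))) has_field_derivative ?\<psi>'' i j x) (at (x j))" for i j x
    by (cases "i = 0"; cases "i = 1"; cases "j = 0"; cases "j = 1")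
       (auto intro!: derivative_eq_intros simp: power2_eq_square)
  have L: "L (\<lambda>y. (exp (b * w y) + (-1)) * f y) =
      (\<lambda>y. b * exp (b * w y) * f y * L w y + (exp (b * w y) + (-1)) * L f y
        + b\<^sup>2 * exp (b * w y) * f y * sq_field L w w y + b * exp (b * w y) * sq_field L w f y
        + b * exp (b * w y) * sq_field L f w y)"
    using compose_exp_polynomial(2)[OF p _ _ d1 d2, where r = 2 and F = "\<lambda>i. if i = 0 then w else f"]
      assms
    by (simp add: tuple_at_def numeral_2_eq_2 add.assoc)
  have "sq_field L f w = sq_field L w f"
    by (simp add: sq_field_def mult.commute algebra_simps)
  then show ?thesis
    unfolding sq_field_def[of L "\<lambda>y. exp (b * w y) + (-1)" f] L exp_weight_L[OF assms(1)]
    by (simp add: fun_eq_iff) (simp add: algebra_simps)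
qed

text \<open>
  The Leibniz rule for the square field compares \<open>L\<close> on a product of three functions with \<open>L\<close> on
  products of two, so the diffusion property is needed for the product of three coordinates.
\<close>
lemma (in diffusion_operator) L_triple:
  assumes "f \<in> A" "g \<in> A" "h \<in> A"
  shows "L (\<lambda>y. f y * g y * h y) = (\<lambda>y. g y * h y * L f y + f y * h y * L g y + f y * g y * L h y
    + 2 * h y * sq_field L f g y + 2 * g y * sq_field L f h y + 2 * f y * sq_field L g h y)"
proof -
  let ?\<psi> = "\<lambda>x::nat \<Rightarrow> real. x 0 * x 1 * x 2"
  let ?\<psi>' = "\<lambda>(i::nat) x::nat \<Rightarrow> real. if i = 0 then x 1 * x 2 else if i = 1 then x 0 * x 2
                else if i = 2 then x 0 * x 1 else 0"
  \<comment> \<open>For distinct \<open>i\<close> and \<open>j\<close> the remaining coordinate has index \<open>3 - i - j\<close>.\<close>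
  let ?\<psi>'' = "\<lambda>(i::nat) (j::nat) x::nat \<Rightarrow> real. if i = j \<or> i > 2 \<or> j > 2 then 0 else x (3 - i - j)"
  have p: "exp_polynomial ?\<psi>"
    by (intro exp_polynomial.intros)
  have d1: "((\<lambda>t. ?\<psi> (x(i := t))) has_field_derivative ?\<psi>' i x) (at (x i))" for i x
    by (cases "i = 0"; cases "i = 1"; cases "i = 2") (auto intro!: derivative_eq_intros)
  have d2: "((\<lambda>t. ?\<psi>' i (x(j := t))) has_field_derivative ?\<psi>'' i j x) (at (x j))" for i j x
    by (cases "i = 0"; cases "i = 1"; cases "i = 2"; cases "j = 0"; cases "j = 1"; cases "j = 2")
       (auto intro!: derivative_eq_intros)
  have sym: "sq_field L k m = sq_field L m k" for k m
    by (simp add: sq_field_def mult.commute algebra_simps)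
  show ?thesis
    using compose_exp_polynomial(2)[OF p _ _ d1 d2,
        where r = 3 and F = "\<lambda>i. if i = 0 then f else if i = 1 then g else h"] assms
    by (simp add: tuple_at_def numeral_3_eq_3 sym[of g f] sym[of h f] sym[of h g])
       (simp add: fun_eq_iff algebra_simps)
qed

sublocale diffusion_operator \<subseteq> leibniz: leibniz_operator A L
proof
  fix f g h assume fgh: "f \<in> A" "g \<in> A" "h \<in> A"
  show "sq_field L (\<lambda>y. f y * g y) h = (\<lambda>y. f y * sq_field L g h y + g y * sq_field L f h y)"
    using fgh by (simp add: sq_field_def[of L "\<lambda>y. f y * g y" h] L_triple leibniz_operator.L_mult
      fun_eq_iff) (simp add: sq_field_def[of L f g] field_simps)
qed (fact L_mem L_add L_scale sq_field_nonneg)+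

section \<open>The conformal change of the operator\<close>

lemma INF_ereal_affine:
  fixes k c :: real and \<phi> :: "'b \<Rightarrow> real"
  assumes "k > 0" "S \<noteq> {}"
  shows "(INF f\<in>S. ereal (k * (\<phi> f + c))) = ereal k * ((INF f\<in>S. ereal (\<phi> f)) + ereal c)"
    (is "?I = ereal k * (?J + ereal c)")
proof (rule antisym)
  obtain f0 where f0: "f0 \<in> S" using assms(2) by blast
  show "?I \<le> ereal k * (?J + ereal c)"
  proof (cases ?I)
    case (real r)
    have "r / k - c \<le> \<phi> f" if "f \<in> S" for f
    proof -
      have "ereal r \<le> ereal (k * (\<phi> f + c))"
        unfolding real[symmetric] using that by (rule INF_lower)
      then show ?thesis
        using assms(1) by (simp add: field_simps)
    qed
    then have "ereal (r / k - c) \<le> ?J"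
      by (intro INF_greatest) simp
    then show ?thesis
      unfolding real using assms(1) by (cases ?J) (simp_all add: field_simps)
  next
    case PInf
    then show ?thesis
      using INF_lower[OF f0, of "\<lambda>f. ereal (k * (\<phi> f + c))"] by simp
  qed simp
  show "ereal k * (?J + ereal c) \<le> ?I"
  proof (rule INF_greatest)
    fix f assume "f \<in> S"
    then have "ereal k * (?J + ereal c) \<le> ereal k * (ereal (\<phi> f) + ereal c)"
      using assms(1) by (intro ereal_mult_left_mono add_right_mono INF_lower) auto
    then show "ereal k * (?J + ereal c) \<le> ereal (k * (\<phi> f + c))" by simp
  qed
qed

text \<open>
  The weight \<open>exp (- 2 w)\<close> need not belong to the algebra, but the weight minus \<open>1\<close> does; the chain rules for
  it are the only facts about the exponential that the computation uses.
\<close>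
locale conformal_change = leibniz_operator A L
  for A :: "('a \<Rightarrow> real) set" and L :: "'a operator" +
  fixes w :: "'a \<Rightarrow> real" and N :: real
  assumes w_mem: "w \<in> A"
    and weight_minus_one_mem: "(\<lambda>y. exp (- 2 * w y) + (-1)) \<in> A"
    and L_weight_minus_one: "L (\<lambda>y. exp (- 2 * w y) + (-1)) =
      (\<lambda>y. exp (- 2 * w y) * (- 2 * L w y + (- 2)\<^sup>2 * sq_field L w w y))"
    and sq_field_weight_minus_one: "f \<in> A \<Longrightarrow> sq_field L (\<lambda>y. exp (- 2 * w y) + (-1)) f =
      (\<lambda>y. - 2 * exp (- 2 * w y) * sq_field L w f y)"
begin

abbreviation weight :: "'a \<Rightarrow> real" where
  "weight y \<equiv> exp (- 2 * w y)"

definition conf_L :: "'a operator" where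
  "conf_L = (\<lambda>f y. weight y * (L f y + (N - 2) * \<Gamma> w f y))"

lemma weight_split: "(\<lambda>y. weight y * f y) = (\<lambda>y. (weight y + (-1)) * f y + f y)"
  by (simp add: algebra_simps)

lemma weight_mem: "f \<in> A \<Longrightarrow> (\<lambda>y. weight y * f y) \<in> A"
  unfolding weight_split by (intro mem weight_minus_one_mem)

lemma sq_field_weight:
  assumes "f \<in> A" "k \<in> A"
  shows "\<Gamma> (\<lambda>y. weight y * f y) k = (\<lambda>y. weight y * (\<Gamma> f k y - 2 * f y * \<Gamma> w k y))"
    and "\<Gamma> k (\<lambda>y. weight y * f y) = (\<lambda>y. weight y * (\<Gamma> f k y - 2 * f y * \<Gamma> w k y))"
proof -
  show *: "\<Gamma> (\<lambda>y. weight y * f y) k = (\<lambda>y. weight y * (\<Gamma> f k y - 2 * f y * \<Gamma> w k y))"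
    unfolding weight_split using assms weight_minus_one_mem
    by (simp only: calculus mem sq_field_weight_minus_one) (simp add: algebra_simps)
  then show "\<Gamma> k (\<lambda>y. weight y * f y) = (\<lambda>y. weight y * (\<Gamma> f k y - 2 * f y * \<Gamma> w k y))"
    by (simp only: sq_field_sym[of k])
qed

lemma L_weight:
  assumes "f \<in> A"
  shows "L (\<lambda>y. weight y * f y) =
    (\<lambda>y. weight y * (L f y - 4 * \<Gamma> w f y + f y * (4 * \<Gamma> w w y - 2 * L w y)))"
  unfolding weight_split using assms weight_minus_one_mem
  by (simp only: calculus mem sq_field_weight_minus_one L_weight_minus_one) (simp add: algebra_simps)

text \<open>The first-order part of the operator does not contribute to the square field, being a derivation.\<close>
lemma conf_sq_field:
  assumes "f \<in> A" "g \<in> A"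
  shows "sq_field conf_L f g = (\<lambda>y. weight y * \<Gamma> f g y)"
  using assms w_mem
  by (simp add: fun_eq_iff sq_field_def[of conf_L]) (simp add: conf_L_def calculus mem field_simps)

sublocale conf: leibniz_operator A conf_L
proof
  show "conf_L f \<in> A" if "f \<in> A" for f
    unfolding conf_L_def using that w_mem by (intro weight_mem mem)
  show "conf_L (\<lambda>x. f x + g x) = (\<lambda>x. conf_L f x + conf_L g x)" if "f \<in> A" "g \<in> A" for f g
    using that w_mem by (simp add: fun_eq_iff conf_L_def calculus) (simp add: algebra_simps)
  show "conf_L (\<lambda>x. c * f x) = (\<lambda>x. c * conf_L f x)" if "f \<in> A" for f c
    using that w_mem by (simp add: fun_eq_iff conf_L_def calculus) (simp add: algebra_simps)
  show "0 \<le> sq_field conf_L f f x" if "f \<in> A" for f x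
    using that by (simp add: conf_sq_field sq_field_nonneg)
  show "sq_field conf_L (\<lambda>y. f y * g y) h =
      (\<lambda>y. f y * sq_field conf_L g h y + g y * sq_field conf_L f h y)"
    if "f \<in> A" "g \<in> A" "h \<in> A" for f g h
    using that by (simp add: fun_eq_iff conf_sq_field calculus mem) (simp add: algebra_simps)
qed

lemma conf_sq_field2:
  assumes "f \<in> A"
  shows "sq_field2 conf_L f f x = (weight x)\<^sup>2 *
    (\<Gamma>\<^sub>2 f f x - (N - 2) * Hessian L w f f x
     + \<Gamma> f f x * (2 * \<Gamma> w w x - L w x - (N - 2) * \<Gamma> w w x)
     - 2 * \<Gamma> w (\<Gamma> f f) x + 2 * \<Gamma> w f x * (L f x + (N - 2) * \<Gamma> w f x))"
proof -
  have *: "conf_L f = (\<lambda>y. weight y * (L f y + (N - 2) * \<Gamma> w f y))"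
    by (simp add: conf_L_def)
  have "sq_field2 conf_L f f x =
      (conf_L (\<lambda>y. weight y * \<Gamma> f f y) x - 2 * (weight x * \<Gamma> f (conf_L f) x)) / 2"
    using assms by (simp add: sq_field2_def conf_sq_field conf.L_mem)
  also have "\<dots> = (weight x)\<^sup>2 *
    (\<Gamma>\<^sub>2 f f x - (N - 2) * Hessian L w f f x
     + \<Gamma> f f x * (2 * \<Gamma> w w x - L w x - (N - 2) * \<Gamma> w w x)
     - 2 * \<Gamma> w (\<Gamma> f f) x + 2 * \<Gamma> w f x * (L f x + (N - 2) * \<Gamma> w f x))"
    unfolding * unfolding conf_L_def using assms w_mem
    by (simp only: L_weight sq_field_weight calculus mem sq_field2_def Hessian_def)
       (simp add: field_simps power2_eq_square sq_field_sym)
  finally show ?thesis .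
qed

lemma conf_sq_field_nested:
  assumes "k \<in> A" "f \<in> A" "g \<in> A"
  shows "sq_field conf_L k (sq_field conf_L f g) x =
    (weight x)\<^sup>2 * (\<Gamma> k (\<Gamma> f g) x - 2 * \<Gamma> f g x * \<Gamma> w k x)"
proof -
  have "sq_field conf_L k (sq_field conf_L f g) x = weight x * \<Gamma> k (\<lambda>y. weight y * \<Gamma> f g y) x"
    using assms weight_mem[OF sq_field_mem[OF assms(2,3)]] by (simp only: conf_sq_field)
  also have "\<dots> = (weight x)\<^sup>2 * (\<Gamma> k (\<Gamma> f g) x - 2 * \<Gamma> f g x * \<Gamma> w k x)"
    using assms w_mem
    by (simp only: sq_field_weight mem sq_field_sym[of "\<Gamma> f g" k] power2_eq_square mult.assoc)
  finally show ?thesis .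
qed

lemma conf_Hessian_self:
  assumes "f \<in> A"
  shows "Hessian conf_L f f w x = (weight x)\<^sup>2 * (\<Gamma> w (\<Gamma> f f) x / 2 - \<Gamma> w w x * \<Gamma> f f x)"
  unfolding conf.Hessian_self[OF assms w_mem] conf_sq_field_nested[OF w_mem assms assms]
  by (simp add: field_simps)

text \<open>
  The derivatives of the weight enter the changed Hessian only with factors \<open>\<Gamma>(g, f)\<close> and \<open>\<Gamma>(g, w)\<close>, which
  vanish at \<open>x\<close>. The degenerate case therefore occurs for both operators simultaneously.
\<close>
lemma conf_Hessian_null:
  assumes "f \<in> A" "g \<in> A" "\<Gamma> g g x = 0"
  shows "Hessian conf_L f g w x = (weight x)\<^sup>2 * Hessian L f g w x"
proof -
  have z: "\<Gamma> f g x = 0" "\<Gamma> g w x = 0" "\<Gamma> w g x = 0"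
    using sq_field_null[OF assms(2,1,3)] sq_field_null[OF assms(2) w_mem assms(3)] by auto
  show ?thesis
    unfolding Hessian_def conf_sq_field_nested[OF assms(2,1) w_mem]
      conf_sq_field_nested[OF w_mem assms(1,2)] conf_sq_field_nested[OF assms(1,2) w_mem] z
    by (simp only: mult_zero_left mult_zero_right diff_zero distrib_left right_diff_distrib
        times_divide_eq_right)
qed

abbreviation defect :: "'a operator \<Rightarrow> ('a \<Rightarrow> real) \<Rightarrow> 'a \<Rightarrow> real" where
  "defect K f x \<equiv> sq_field2 K f f x - 1 / N * (K f x)\<^sup>2"

definition correction :: "('a \<Rightarrow> real) \<Rightarrow> 'a \<Rightarrow> real" where
  "correction f x = (- L w x - (N - 2) * \<Gamma> w w x) * \<Gamma> f f x
    - (N - 2) * Hessian L w f f x + (N - 2) * (\<Gamma> w f x)\<^sup>2"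

text \<open>
  With \<open>m = L f (x)\<close> and \<open>g = \<Gamma>(w, f)(x)\<close> the left-hand side is the contribution of the changed operator, and
  \<open>m - 2 g\<close> is \<open>L\<close> applied to \<open>f\<close> minus its bump with \<open>w\<close>. As \<open>m + (N - 2) g = (m - 2 g) + N g\<close>, the
  factor \<open>1 / N\<close> cancels in the mixed term; this is where the \<open>N\<close> in the drift has to match the dimension.
\<close>
lemma dimension_square:
  assumes "N \<noteq> 0"
  shows "1 / N * (h * (m + (N - 2) * g))\<^sup>2 =
    h\<^sup>2 * (1 / N * (m - 2 * g)\<^sup>2 + 2 * (m - 2 * g) * g + N * g\<^sup>2)"
  using assms by (simp add: field_simps power2_eq_square)

text \<open>
  Subtracting the bump of \<open>f\<close> and \<open>w\<close> produces the terms \<open>- 2 \<Gamma>(w, \<Gamma>(f)) + 2 \<Gamma>(f) \<Gamma>(w)\<close> by which the time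
  change alters \<open>\<Gamma>\<^sub>2(f)\<close>. The previous lemma turns its third term, which involves \<open>L f\<close>, into a multiple of
  \<open>\<Gamma>(w, f)\<^sup>2\<close>. What is left over is the correction.
\<close>
lemma conf_defect:
  assumes "f \<in> A" "N \<noteq> 0"
  shows "defect conf_L f x =
    (weight x)\<^sup>2 * (defect L (\<lambda>y. f y + (-1) * bump x f w y) x + correction f x)"
proof -
  have L: "conf_L f x = weight x * (L f x + (N - 2) * \<Gamma> w f x)"
    by (simp add: conf_L_def)
  show ?thesis
    unfolding L dimension_square[OF assms(2)] conf_sq_field2[OF assms(1)] correction_def
      perturb_L[OF assms(1,1) w_mem] perturb_sq_field2[OF assms(1,1) w_mem]
      Hessian_self[OF assms(1) w_mem] sq_field_sym[of f w]
    by (simp add: power2_eq_square algebra_simps)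
qed

text \<open>
  The opposite comparison. Adding and then subtracting the bump does not return \<open>f\<close>, so this is not an instance
  of the previous identity; it follows from the perturbation formulas for the changed operator.
\<close>
lemma conf_defect_perturb:
  assumes "f \<in> A" "N \<noteq> 0"
  shows "defect conf_L (\<lambda>y. f y + 1 * bump x f w y) x =
    (weight x)\<^sup>2 * (defect L f x + correction f x)"
proof -
  have "conf_L f x + 2 * 1 * (weight x * \<Gamma> w f x) =
      weight x * ((L f x + 2 * \<Gamma> w f x) + (N - 2) * \<Gamma> w f x)"
    by (simp add: conf_L_def algebra_simps)
  note L = this dimension_square[OF assms(2)]
  show ?thesis
    unfolding conf.perturb_L[OF assms(1,1) w_mem] conf.perturb_sq_field2[OF assms(1,1) w_mem]
      conf_sq_field[OF assms(1) w_mem] conf_sq_field[OF assms(1,1)] conf_sq_field[OF w_mem w_mem]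
      sq_field_sym[of f w] L conf_sq_field2[OF assms(1)] conf_Hessian_self[OF assms(1)]
      correction_def
    by (simp add: power2_eq_square algebra_simps)
qed

lemma conf_admissible:
  assumes "f \<in> A" "u \<in> A"
  shows "sq_field conf_L (\<lambda>y. f y - u y) (\<lambda>y. f y - u y) x = 0 \<longleftrightarrow>
    \<Gamma> (\<lambda>y. f y - u y) (\<lambda>y. f y - u y) x = 0"
  using assms by (simp add: conf_sq_field diff_mem)

lemma N_Ricci_conf:
  assumes "N \<ge> 1" "u \<in> A"
  shows "N_Ricci A conf_L (ereal N) u x =
    ereal ((weight x)\<^sup>2) * (N_Ricci A L (ereal N) u x + ereal (correction u x))"
proof -
  define S where "S = {f \<in> A. \<Gamma> (\<lambda>y. f y - u y) (\<lambda>y. f y - u y) x = 0}"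
  have N: "N \<noteq> 0" "real_of_ereal (1 / ereal N) = 1 / N"
    using assms(1) by (auto simp: one_ereal_def)
  have R: "N_Ricci A L (ereal N) u x = (INF f\<in>S. ereal (defect L f x))"
    by (simp add: N_Ricci_def S_def N)
  have R': "N_Ricci A conf_L (ereal N) u x = (INF f\<in>S. ereal (defect conf_L f x))"
    unfolding N_Ricci_def S_def N
    by (intro INF_cong) (auto simp: conf_admissible assms(2))
  have pos: "(weight x)\<^sup>2 > 0" by simp
  \<comment> \<open>The first case is that of a Hessian which is not determined by differentials at \<open>x\<close>.\<close>
  show ?thesis
  proof (cases "\<exists>f\<in>S. \<exists>g\<in>A. \<Gamma> g g x = 0 \<and> Hessian L f g w x \<noteq> 0")
    case True
    then obtain f g where fg: "f \<in> A" "g \<in> A" "\<Gamma> (\<lambda>y. f y - u y) (\<lambda>y. f y - u y) x = 0"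
      "\<Gamma> g g x = 0" "Hessian L f g w x \<noteq> 0"
      by (auto simp: S_def)
    have "N_Ricci A L (ereal N) u x = -\<infinity>"
      using fg w_mem assms(2) by (intro N_Ricci_degenerate[of u f g w])
    moreover have "N_Ricci A conf_L (ereal N) u x = -\<infinity>"
    proof (rule conf.N_Ricci_degenerate[of u f g w])
      show "sq_field conf_L (\<lambda>y. f y - u y) (\<lambda>y. f y - u y) x = 0"
        using fg assms(2) by (simp add: conf_admissible)
    qed (use fg w_mem assms(2) in \<open>auto simp: conf_sq_field conf_Hessian_null\<close>)
    ultimately show ?thesis using pos by (simp del: zero_less_power2 zero_less_power)
  next
    case False
    have u: "u \<in> S"
      unfolding S_def using sq_field_diff[OF assms(2,2) diff_mem[OF assms(2,2)]] assms(2)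
      by (auto dest: fun_cong)
    have corr: "correction f x = correction u x" if "f \<in> S" for f
    proof -
      let ?g = "\<lambda>y. f y - u y"
      have f: "f \<in> A" "\<Gamma> ?g ?g x = 0" and g: "?g \<in> A"
        using that assms(2) diff_mem by (auto simp: S_def)
      have "Hessian L w ?g f x = 0" "Hessian L w ?g u x = 0"
        using False that u f(2) g Hessian_null[OF f(1) g w_mem f(2)]
          Hessian_null[OF assms(2) g w_mem f(2)] by auto
      then have "Hessian L w f f x = Hessian L w u u x"
        using f w_mem assms(2) by (intro Hessian_cong)
      moreover have "\<Gamma> k f x = \<Gamma> k u x" if "k \<in> A" for k
        using f that assms(2) by (intro sq_field_cong)
      ultimately show ?thesis
        using f(1) assms(2) w_mem by (simp add: correction_def sq_field_sym[of f u])
    qed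
    have "N_Ricci A conf_L (ereal N) u x =
        (INF f\<in>S. ereal ((weight x)\<^sup>2 * (defect L f x + correction u x)))"
      unfolding R'
    proof (rule antisym; rule INF_mono)
      fix f assume f: "f \<in> S"
      then have "f \<in> A" and perturb_S: "(\<lambda>y. f y + c * bump x f w y) \<in> S" for c
        using w_mem assms(2) by (simp_all add: S_def perturb_mem perturb_admissible)
      then show "\<exists>p\<in>S. ereal (defect conf_L p x)
          \<le> ereal ((weight x)\<^sup>2 * (defect L f x + correction u x))"
        using conf_defect_perturb[of f x] N(1) corr[OF f] by (intro bexI[OF _ perturb_S[of 1]]) simp
      show "\<exists>p\<in>S. ereal ((weight x)\<^sup>2 * (defect L p x + correction u x))
          \<le> ereal (defect conf_L f x)"
        using \<open>f \<in> A\<close> conf_defect[of f x] N(1) corr[OF f]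
        by (intro bexI[OF _ perturb_S[of "-1"]]) simp
    qed
    also have "\<dots> = ereal ((weight x)\<^sup>2) * ((INF f\<in>S. ereal (defect L f x)) + ereal (correction u x))"
      using pos u by (intro INF_ereal_affine) auto
    finally show ?thesis
      by (simp only: R)
  qed
qed

end

theorem theorem7p2:
  fixes A :: "('a \<Rightarrow> real) set" and L :: "'a operator"
    and w u :: "'a \<Rightarrow> real" and N :: real and x :: 'a
  assumes "diffusion_operator A L"
    and "w \<in> A" and "1 \<le> N" and "u \<in> A"
  shows "N_Ricci A (\<lambda>f y. exp (- 2 * w y) * (L f y + (N - 2) * sq_field L w f y)) (ereal N) u x =
    ereal (exp (- 4 * w x)) *
    (N_Ricci A L (ereal N) u x +
     ereal ((- L w x - (N - 2) * sq_field L w w x) * sq_field L u u x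
            - (N - 2) * Hessian L w u u x
            + (N - 2) * (sq_field L w u x)\<^sup>2))"
proof -
  interpret diffusion_operator A L by (fact assms(1))
  interpret conformal_change A L w N
    using exp_weight_mem[OF assms(2), of "- 2"] exp_weight_L[OF assms(2), of "- 2"]
      exp_weight_sq_field[OF assms(2), of _ "- 2"] assms(2)
    by unfold_locales
  have "(exp (- 2 * w x))\<^sup>2 = exp (- 4 * w x)"
    by (simp add: power2_eq_square flip: exp_add)
  then show ?thesis
    using N_Ricci_conf[OF assms(3,4), of x] by (simp only: conf_L_def correction_def)
qed

end
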